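(* Let $\mathbb{K}$ be a commutative field, $\mathcal{A}$ a generic arrangement of $6$ planes in $\mathbb{K}^3$, $\mathcal{Q}_3(\mathcal{B}(6,3,\mathcal{A}))$ the set of non-very generic intersections of $\mathcal{B}(6,3,\mathcal{A})$ and $m_3(\mathcal{A})$ its cardinality. There is one and only one partition $\mathcal{V}_\nu$ of the vertex set of the graph $\phi(K_6)$ (where $\nu$ denotes its type) such that $\mathcal{Q}_3(\mathcal{B}(6,3,\mathcal{A}))$ is exactly the set of the intersections $\bigcap_{L\in\mathbb{T}}D_L$, with $\mathbb{T}$ ranging over the $3$-sets corresponding to the edges of $\phi(K_6)[\mathcal{V}_\nu]$. In particular $m_3(\mathcal{A})=m(\nu)$.
   Context: A generic arrangement of $6$ planes in $\mathbb{K}^3$ is a central arrangement $H_i=\ker\alpha_i$, $i=1,\dots,6$, such that any three of the $\alpha_i$ are linearly independent. Its translates $\{H_1^{x_1},\dots,H_6^{x_6}\}$, with $H_i^{x_i}$ parallel to $H_i$ (up to rescaling of $x_i$, $H_i^{x_i}=\{v:\alpha_i(v)=x_i\}$), are parametrized by $x\in\mathbb{K}^6$. For $L\subset\{1,\dots,6\}$ with $|L|=4$, $D_L\subset\mathbb{K}^6$ is the hyperplane of translates whose four planes indexed by $L$ have a common point; $\mathcal{B}(6,3,\mathcal{A})$ is the arrangement of all $D_L$. Correspondence with permutations: the permutation $(p_1p_2)(p_3p_4)(p_5p_6)\in S_6$, with $\{p_1,\dots,p_6\}=\{1,\dots,6\}$, corresponds to the $3$-set $\mathbb{T}=\{\{p_1,p_2,p_3,p_4\},\{p_3,p_4,p_5,p_6\},\{p_1,p_2,p_5,p_6\}\}$.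 The non-very generic intersections of $\mathcal{B}(6,3,\mathcal{A})$ are the intersections $X=\bigcap_{L\in\mathbb{T}}D_L$, with $\mathbb{T}$ a $3$-set of this form, whose codimension is strictly less than $3$ (i.e. the three hyperplanes $D_L$, $L\in\mathbb{T}$, are linearly dependent). (In general, an intersection is non-very generic if it is not combinatorially isomorphic to an intersection in $\mathcal{B}(6,3,\mathcal{A}')$ with $\mathcal{A}'$ very generic, i.e. with $\mathcal{A}'$ in the Zariski open set of generic arrangements whose discriminantal arrangement has intersection lattice of maximum cardinality.) Graph: $\phi$ is the outer automorphism of $S_6$ defined by $\phi((12))=(15)(26)(34)$, $\phi((23))=(12)(35)(46)$, $\phi((34))=(15)(24)(36)$, $\phi((45))=(14)(26)(35)$, $\phi((56))=(15)(23)(46)$. $\phi(K_6)$ is the complete graph on vertices $\phi(1),\dots,\phi(6)$ in which the edge joining $\phi(i)$ and $\phi(j)$ is identified with the permutation $\phi((ij))$ (a product of three disjoint transpositions). A partition of the vertex set has type $\nu=i_1^{n_1}\cdots i_l^{n_l}$ if it has exactly $n_j$ blocks of size $i_j$ for each $j$; such a partition is written $\mathcal{V}_\nu$, and $\phi(K_6)[\mathcal{V}_\nu]$ is the subgraph whose connected components are the complete graphs on the blocks. Its number of edges is $m(\nu)=\sum_jn_j\binom{i_j}{2}$. *)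

theory Defs
  imports
    "HOL-Analysis.Cartesian_Space"
    "HOL-Library.Numeral_Type"
    "HOL-Library.Disjoint_Sets"
    "HOL-Library.Multiset"
    "HOL-Combinatorics.Transposition"
    "HOL-Algebra.Bij"
begin

text \<open>The index set \<open>{1,\<dots>,6}\<close> is the six-element type \<open>6\<close>. Its numerals are read modulo \<open>6\<close>,
  so that \<open>1, 2, 3, 4, 5, 6\<close> are its six distinct elements and \<open>(6 :: 6) = 0\<close>.
  A linear form \<open>\<alpha>\<close> on \<open>'k ^ 3\<close> is given by its coefficient vector.\<close>

definition lin_form :: "'k::field ^ 3 \<Rightarrow> 'k ^ 3 \<Rightarrow> 'k" where
  "lin_form a v = (\<Sum>j\<in>UNIV. a $ j * v $ j)"

definition plane :: "'k::field ^ 3 \<Rightarrow> 'k \<Rightarrow> ('k ^ 3) set" where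
  "plane a c = {v. lin_form a v = c}"

text \<open>\<open>inj_on\<close> is needed because \<open>vec.independent\<close> is a predicate on sets, which would not see
  repeated forms.\<close>

definition generic_arrangement :: "(6 \<Rightarrow> 'k::field ^ 3) \<Rightarrow> bool" where
  "generic_arrangement \<alpha> \<longleftrightarrow>
     (\<forall>S. card S = 3 \<longrightarrow> inj_on \<alpha> S \<and> vec.independent (\<alpha> ` S))"

definition D :: "(6 \<Rightarrow> 'k::field ^ 3) \<Rightarrow> 6 set \<Rightarrow> ('k ^ 6) set" where
  "D \<alpha> L = {x. (\<Inter>i\<in>L. plane (\<alpha> i) (x $ i)) \<noteq> {}}"

definition codim :: "('k::field ^ 'n) set \<Rightarrow> nat" where
  "codim X = CARD('n) - vec.dim X"

text \<open>\<open>transpose\<close> alone would denote the transpose of a matrix.\<close>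

abbreviation transp :: "6 \<Rightarrow> 6 \<Rightarrow> 6 \<Rightarrow> 6" where
  "transp \<equiv> Transposition.transpose"

definition corresponds :: "(6 \<Rightarrow> 6) \<Rightarrow> 6 set set \<Rightarrow> bool" where
  "corresponds \<sigma> T \<longleftrightarrow>
     (\<exists>p1 p2 p3 p4 p5 p6. {p1, p2, p3, p4, p5, p6} = UNIV \<and>
        \<sigma> = transp p1 p2 \<circ> transp p3 p4 \<circ> transp p5 p6 \<and>
        T = {{p1, p2, p3, p4}, {p3, p4, p5, p6}, {p1, p2, p5, p6}})"

definition nonvery_generic :: "(6 \<Rightarrow> 'k::field ^ 3) \<Rightarrow> ('k ^ 6) set set" where
  "nonvery_generic \<alpha> =
     {X. \<exists>\<sigma> T. corresponds \<sigma> T \<and> X = (\<Inter>L\<in>T. D \<alpha> L) \<and> codim X < 3}"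

definition m3 :: "(6 \<Rightarrow> 'k::field ^ 3) \<Rightarrow> nat" where
  "m3 \<alpha> = card (nonvery_generic \<alpha>)"

text \<open>\<open>BijGroup UNIV\<close> is the symmetric group on the six indices, and \<open>auto\<close> its group of
  automorphisms, which by definition are \<open>undefined\<close> outside the carrier. As the adjacent
  transpositions generate the symmetric group, at most one automorphism has the prescribed values.\<close>

definition phi :: "(6 \<Rightarrow> 6) \<Rightarrow> (6 \<Rightarrow> 6)" where
  "phi = (THE f. f \<in> auto (BijGroup UNIV) \<and>
     f (transp 1 2) = transp 1 5 \<circ> transp 2 6 \<circ> transp 3 4 \<and>
     f (transp 2 3) = transp 1 2 \<circ> transp 3 5 \<circ> transp 4 6 \<and>
     f (transp 3 4) = transp 1 5 \<circ> transp 2 4 \<circ> transp 3 6 \<and>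
     f (transp 4 5) = transp 1 4 \<circ> transp 2 6 \<circ> transp 3 5 \<and>
     f (transp 5 6) = transp 1 5 \<circ> transp 2 3 \<circ> transp 4 6)"

text \<open>The vertex \<open>\<phi>(i)\<close> of \<open>\<phi>(K\<^sub>6)\<close> is represented by \<open>i\<close>. The edge between \<open>\<phi>(i)\<close> and \<open>\<phi>(j)\<close> is
  identified with the permutation \<open>\<phi>((i j))\<close>; \<open>phi_edges P\<close> are the edges of the disjoint union of
  the complete graphs on the blocks of \<open>P\<close>.\<close>

definition phi_edges :: "6 set set \<Rightarrow> (6 \<Rightarrow> 6) set" where
  "phi_edges P = {phi (transp i j) | i j. i \<noteq> j \<and> (\<exists>B\<in>P. i \<in> B \<and> j \<in> B)}"

text \<open>The type \<open>\<nu>\<close> of a partition is the multiset of its block sizes, so that \<open>n\<^sub>j\<close> is the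
  multiplicity of \<open>i\<^sub>j\<close> in \<open>\<nu>\<close>.\<close>

definition partition_type :: "6 set set \<Rightarrow> nat multiset" where
  "partition_type P = image_mset card (mset_set P)"

definition m_nu :: "nat multiset \<Rightarrow> nat" where
  "m_nu \<nu> = (\<Sum>i\<in>set_mset \<nu>. count \<nu> i * (i choose 2))"

end

theory Submission
  imports Defs "HOL-Combinatorics.Permutations" "HOL-Analysis.Determinants"
begin

text \<open>
  Read the forms \<open>\<alpha> i\<close> as six points in general position in the projective plane. The intersection
  belonging to \<open>(p1 p2)(p3 p4)(p5 p6)\<close> contains the \<open>3\<close>-dimensional space of translates with a common
  point, and it is larger exactly when the lines \<open>p1p2\<close>, \<open>p3p4\<close>, \<open>p5p6\<close> are concurrent. Pappus's theorem
  says that if \<open>(ab)(cd)(ef)\<close> and \<open>(bc)(de)(fa)\<close> are degenerate in this sense, then so is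
  \<open>(ad)(cf)(eb)\<close>, which is the conjugate of the second by the first. As \<open>\<phi>((i k))\<close> is the conjugate of
  \<open>\<phi>((j k))\<close> by \<open>\<phi>((i j))\<close>, degeneracy of \<open>\<phi>((i j))\<close> is a transitive relation in \<open>i, j\<close>, and its classes
  form the partition. Different degenerate synthemes give different intersections, because a further
  \<open>D\<^sub>L\<close> cuts a degenerate intersection down to the translates with a common point.
\<close>

section \<open>The outer automorphism\<close>

lemma UNIV_6: "(UNIV :: 6 set) = {1, 2, 3, 4, 5, 6}"
  by (rule card_subset_eq [symmetric]) simp_all

lemma all_6: "(\<forall>x::6. P x) \<longleftrightarrow> P 1 \<and> P 2 \<and> P 3 \<and> P 4 \<and> P 5 \<and> P 6"
  using UNIV_6 by (metis UNIV_I empty_iff insert_iff)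

lemma fun_eq_6: "f = g \<longleftrightarrow> f 1 = g 1 \<and> f 2 = g 2 \<and> f 3 = g 3 \<and> f 4 = g 4 \<and> f 5 = g 5 \<and> f 6 = g 6"
  for f g :: "6 \<Rightarrow> 'a"
  unfolding fun_eq_iff all_6 ..

lemma ex_notin_6:
  assumes "length xs < 6"
  shows "\<exists>x::6. x \<notin> set xs"
proof (rule ccontr)
  assume "\<nexists>x. x \<notin> set xs"
  then have "set xs = UNIV"
    by blast
  then have "card (set xs) = 6"
    by simp
  then show False
    using assms card_length [of xs] by simp
qed

lemma UNIV_eq_6:
  assumes "distinct [a, b, c, d, e, f]"
  shows "(UNIV :: 6 set) = {a, b, c, d, e, f}"
  using assms by (intro card_subset_eq [symmetric]) simp_all

definition adjacent :: "(6 \<times> 6) set" where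
  "adjacent = {(1,2), (2,3), (3,4), (4,5), (5,6)}"

text \<open>Arbitrary transpositions generate all permutations of a finite set, and conjugation
  builds each of them from adjacent ones.\<close>

lemma bij_adjacent_induct [consumes 1, case_names id transp]:
  assumes "bij f" and id: "P id"
    and step: "\<And>a b g. (a, b) \<in> adjacent \<Longrightarrow> bij g \<Longrightarrow> P g \<Longrightarrow> P (transp a b \<circ> g)"
  shows "P f"
proof -
  \<comment> \<open>As a relation on points, \<open>Q\<close> is symmetric and, by conjugation,
    transitive between distinct points, so the chain from 1 to 6 yields all pairs.\<close>
  define Q where "Q a b \<longleftrightarrow> (\<forall>g. bij g \<and> P g \<longrightarrow> P (transp a b \<circ> g))" for a b
  have adjacent: "Q a b" if "(a, b) \<in> adjacent" for a b
    using step that by (auto simp: Q_def)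
  have sym: "Q b a" if "Q a b" for a b
    using that by (simp add: Q_def transpose_commute)
  have trans: "Q a c" if "Q a b" "Q b c" "a \<noteq> c" for a b c
  proof (cases "a = b \<or> b = c")
    case False
    have eq: "transp a c = transp a b \<circ> (transp b c \<circ> transp a b)"
      using False that(3) by (simp add: transpose_comp_triple flip: comp_assoc)
    have "P (transp a b \<circ> (transp b c \<circ> (transp a b \<circ> g)))" if "bij g" "P g" for g
      using \<open>Q a b\<close> \<open>Q b c\<close> that unfolding Q_def by (metis bij_comp bij_transpose)
    then show ?thesis unfolding Q_def eq by (simp add: comp_assoc)
  qed (use that in auto)
  have Q: "Q 1 2" "Q 2 3" "Q 3 4" "Q 4 5" "Q 5 6"
    by (auto intro!: adjacent simp: adjacent_def)
  have all: "\<forall>a b. a \<noteq> b \<longrightarrow> Q a b"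
  proof -
    have Q': "Q 1 3" "Q 2 4" "Q 3 5" "Q 4 6"
      using trans [OF Q(1,2)] trans [OF Q(2,3)] trans [OF Q(3,4)] trans [OF Q(4,5)] by simp_all
    have Q'': "Q 1 4" "Q 2 5" "Q 3 6"
      using trans [OF Q(1) Q'(2)] trans [OF Q(2) Q'(3)] trans [OF Q(3) Q'(4)] by simp_all
    have R: "Q 1 5" "Q 2 6" "Q 1 6"
      using trans [OF Q(1) Q''(2)] trans [OF Q(2) Q''(3)] trans [OF Q'(1) Q''(3)] by simp_all
    show ?thesis
      unfolding all_6
      by (simp add: Q Q' Q'' R Q [THEN sym] Q' [THEN sym] Q'' [THEN sym] R [THEN sym])
  qed
  have "f permutes UNIV" "finite (UNIV :: 6 set)"
    using \<open>bij f\<close> by (auto intro!: bij_imp_permutes)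
  then show ?thesis
  proof (induction rule: permutes_induct)
    case (swap a b p)
    then have "Q a b" "bij p"
      using all by (simp_all add: permutes_bij)
    then show ?case
      using swap.IH unfolding Q_def by blast
  qed (rule id)
qed

section \<open>Synthemes labelled by pairs\<close>

text \<open>The preimage of \<open>(i j)\<close> under \<open>\<phi>\<close>, junk for \<open>i = j\<close>.\<close>

definition syn_of_pair :: "6 \<Rightarrow> 6 \<Rightarrow> 6 \<Rightarrow> 6" where
  "syn_of_pair i j =
    (if {i, j} = {1, 2} then transp 1 5 \<circ> transp 2 3 \<circ> transp 4 6
     else if {i, j} = {1, 3} then transp 1 4 \<circ> transp 2 5 \<circ> transp 3 6
     else if {i, j} = {1, 4} then transp 1 3 \<circ> transp 2 6 \<circ> transp 4 5
     else if {i, j} = {1, 5} then transp 1 2 \<circ> transp 3 4 \<circ> transp 5 6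
     else if {i, j} = {1, 6} then transp 1 6 \<circ> transp 2 4 \<circ> transp 3 5
     else if {i, j} = {2, 3} then transp 1 3 \<circ> transp 2 4 \<circ> transp 5 6
     else if {i, j} = {2, 4} then transp 1 6 \<circ> transp 2 5 \<circ> transp 3 4
     else if {i, j} = {2, 5} then transp 1 4 \<circ> transp 2 6 \<circ> transp 3 5
     else if {i, j} = {2, 6} then transp 1 2 \<circ> transp 3 6 \<circ> transp 4 5
     else if {i, j} = {3, 4} then transp 1 2 \<circ> transp 3 5 \<circ> transp 4 6
     else if {i, j} = {3, 5} then transp 1 6 \<circ> transp 2 3 \<circ> transp 4 5
     else if {i, j} = {3, 6} then transp 1 5 \<circ> transp 2 6 \<circ> transp 3 4
     else if {i, j} = {4, 5} then transp 1 5 \<circ> transp 2 4 \<circ> transp 3 6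
     else if {i, j} = {4, 6} then transp 1 4 \<circ> transp 2 3 \<circ> transp 5 6
     else transp 1 3 \<circ> transp 2 5 \<circ> transp 4 6)"

lemma syn_of_pair_commute: "syn_of_pair i j = syn_of_pair j i"
  by (simp add: syn_of_pair_def insert_commute)

lemma syn_of_pair_simps:
  "syn_of_pair 1 2 = transp 1 5 \<circ> transp 2 3 \<circ> transp 4 6"
  "syn_of_pair 1 3 = transp 1 4 \<circ> transp 2 5 \<circ> transp 3 6"
  "syn_of_pair 1 4 = transp 1 3 \<circ> transp 2 6 \<circ> transp 4 5"
  "syn_of_pair 1 5 = transp 1 2 \<circ> transp 3 4 \<circ> transp 5 6"
  "syn_of_pair 1 6 = transp 1 6 \<circ> transp 2 4 \<circ> transp 3 5"
  "syn_of_pair 2 3 = transp 1 3 \<circ> transp 2 4 \<circ> transp 5 6"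
  "syn_of_pair 2 4 = transp 1 6 \<circ> transp 2 5 \<circ> transp 3 4"
  "syn_of_pair 2 5 = transp 1 4 \<circ> transp 2 6 \<circ> transp 3 5"
  "syn_of_pair 2 6 = transp 1 2 \<circ> transp 3 6 \<circ> transp 4 5"
  "syn_of_pair 3 4 = transp 1 2 \<circ> transp 3 5 \<circ> transp 4 6"
  "syn_of_pair 3 5 = transp 1 6 \<circ> transp 2 3 \<circ> transp 4 5"
  "syn_of_pair 3 6 = transp 1 5 \<circ> transp 2 6 \<circ> transp 3 4"
  "syn_of_pair 4 5 = transp 1 5 \<circ> transp 2 4 \<circ> transp 3 6"
  "syn_of_pair 4 6 = transp 1 4 \<circ> transp 2 3 \<circ> transp 5 6"
  "syn_of_pair 5 6 = transp 1 3 \<circ> transp 2 5 \<circ> transp 4 6"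
  by (simp_all add: syn_of_pair_def doubleton_eq_iff)

lemmas syn_of_pair_simps_swap = syn_of_pair_simps [THEN trans [OF syn_of_pair_commute]]

text \<open>Conjugation by \<open>g\<close> permutes the synthemes \<open>syn_of_pair i j\<close> as \<open>h = \<phi>(g)\<close> permutes the indices.\<close>

definition intertwines :: "(6 \<Rightarrow> 6) \<Rightarrow> (6 \<Rightarrow> 6) \<Rightarrow> bool" where
  "intertwines g h \<longleftrightarrow> bij h \<and> (\<forall>i j. i \<noteq> j \<longrightarrow> g \<circ> syn_of_pair i j = syn_of_pair (h i) (h j) \<circ> g)"

text \<open>The second arguments are the values prescribed for \<open>phi\<close>; a finite check
  over all pairs of indices.\<close>

lemma intertwines_generators:
  "intertwines (transp 1 2) (transp 1 5 \<circ> transp 2 6 \<circ> transp 3 4)"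
  "intertwines (transp 2 3) (transp 1 2 \<circ> transp 3 5 \<circ> transp 4 6)"
  "intertwines (transp 3 4) (transp 1 5 \<circ> transp 2 4 \<circ> transp 3 6)"
  "intertwines (transp 4 5) (transp 1 4 \<circ> transp 2 6 \<circ> transp 3 5)"
  "intertwines (transp 5 6) (transp 1 5 \<circ> transp 2 3 \<circ> transp 4 6)"
  unfolding intertwines_def all_6
  by (simp_all add: syn_of_pair_simps syn_of_pair_simps_swap fun_eq_6 bij_comp bij_swap_iff)

text \<open>Every adjacent transposition thus occurs as a second argument, which is the source of
  the surjectivity of \<open>phi\<close>.\<close>

lemma intertwines_syn_of_pair:
  assumes "(a, b) \<in> adjacent"
  shows "intertwines (syn_of_pair a b) (transp a b)"
  using assms unfolding adjacent_def intertwines_def all_6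
  by (auto simp: syn_of_pair_simps syn_of_pair_simps_swap fun_eq_6)

lemma syn_of_pair_inj:
  assumes "i \<noteq> j" "k \<noteq> l" "syn_of_pair i j = syn_of_pair k l"
  shows "{i, j} = {k, l}"
proof -
  have "\<forall>i j. i \<noteq> j \<longrightarrow> (\<forall>k l. k \<noteq> l \<longrightarrow> syn_of_pair i j = syn_of_pair k l \<longrightarrow> {i, j} = {k, l})"
    unfolding all_6 by (simp add: syn_of_pair_simps syn_of_pair_simps_swap fun_eq_6 doubleton_eq_iff)
  then show ?thesis
    using assms by blast
qed

lemma bij_syn_of_pair: "bij (syn_of_pair i j)"
  by (simp add: syn_of_pair_def bij_comp)

lemma intertwines_id: "intertwines id id"
  by (simp add: intertwines_def)

lemma intertwines_comp:
  assumes "intertwines g h" "intertwines g' h'"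
  shows "intertwines (g \<circ> g') (h \<circ> h')"
proof -
  have "g \<circ> g' \<circ> syn_of_pair i j = syn_of_pair (h (h' i)) (h (h' j)) \<circ> (g \<circ> g')" if "i \<noteq> j" for i j
  proof -
    have "h' i \<noteq> h' j"
      using assms(2) that by (auto simp: intertwines_def dest: bij_is_inj injD)
    then show ?thesis
      using assms that unfolding intertwines_def by (metis comp_assoc)
  qed
  then show ?thesis
    using assms by (auto simp: intertwines_def bij_comp)
qed

lemma intertwines_total:
  assumes "bij g"
  shows "\<exists>h. intertwines g h"
  using assms
proof (induction rule: bij_adjacent_induct)
  case id
  show ?case
    using intertwines_id by blast
next
  case (transp a b g)
  then have "\<exists>h. intertwines (transp a b) h"
    using intertwines_generators by (auto simp: adjacent_def)
  then show ?case
    using transp intertwines_comp by blast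
qed

lemma intertwines_surj:
  assumes "bij h"
  shows "\<exists>g. bij g \<and> intertwines g h"
  using assms
proof (induction rule: bij_adjacent_induct)
  case id
  show ?case
    using intertwines_id by blast
next
  case (transp a b h)
  then show ?case
    using intertwines_comp intertwines_syn_of_pair bij_syn_of_pair bij_comp by blast
qed

text \<open>Different pairs carry different synthemes, so \<open>g\<close> determines the image
  under \<open>h\<close> of every pair. Two pairs through \<open>i\<close> meet only in
  \<open>i\<close>, which pins down \<open>h i\<close>.\<close>

lemma intertwines_unique:
  assumes "bij g" "intertwines g h" "intertwines g h'"
  shows "h = h'"
proof
  fix i
  have pairs: "{h i, h j} = {h' i, h' j}" if "i \<noteq> j" for j
  proof (rule syn_of_pair_inj)
    have "syn_of_pair (h i) (h j) \<circ> g = syn_of_pair (h' i) (h' j) \<circ> g"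
      using assms that by (metis intertwines_def)
    then show "syn_of_pair (h i) (h j) = syn_of_pair (h' i) (h' j)"
      using assms(1) by (metis bij_is_surj comp_assoc comp_id surj_iff)
  qed (use assms that in \<open>auto simp: intertwines_def dest: bij_is_inj injD\<close>)
  obtain j k where "i \<noteq> j" "i \<noteq> k" "j \<noteq> k"
    using ex_notin_6 [of "[i]"] ex_notin_6 [of "[i, _]"] by simp metis
  moreover from this have "h j \<noteq> h k"
    using assms(2) by (auto simp: intertwines_def dest: bij_is_inj injD)
  ultimately show "h i = h' i"
    using pairs [of j] pairs [of k] by (auto simp: doubleton_eq_iff)
qed

section \<open>Existence and uniqueness of the automorphism\<close>

lemma auto_BijGroup_UNIV:
  "f \<in> auto (BijGroup UNIV) \<longleftrightarrow>
     f \<in> extensional {g. bij g} \<and> bij_betw f {g. bij g} {g. bij g} \<and>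
     (\<forall>g h. bij g \<longrightarrow> bij h \<longrightarrow> f (g \<circ> h) = f g \<circ> f h)"
proof -
  have Bij: "Bij (UNIV :: 'a set) = {g. bij g}"
    by (auto simp: Bij_def)
  have carrier: "carrier (BijGroup (UNIV :: 'a set)) = {g. bij g}"
    by (simp add: BijGroup_def Bij)
  have mult: "g \<otimes>\<^bsub>BijGroup UNIV\<^esub> h = g \<circ> h" if "bij g" "bij h" for g h :: "'a \<Rightarrow> 'a"
    using that by (simp add: BijGroup_def Bij compose_def fun_eq_iff)
  have "f g \<otimes>\<^bsub>BijGroup UNIV\<^esub> f h = f g \<circ> f h"
    if "bij_betw f {g. bij g} {g. bij g}" "bij g" "bij h" for g h
    using that by (intro mult) (auto dest: bij_betwE)
  then show ?thesis
    by (auto simp: auto_def Bij_def hom_def carrier mult dest: bij_betw_imp_funcset bij_betwE)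
qed

definition phi_spec :: "((6 \<Rightarrow> 6) \<Rightarrow> (6 \<Rightarrow> 6)) \<Rightarrow> bool" where
  "phi_spec f \<longleftrightarrow> f \<in> auto (BijGroup UNIV) \<and>
     f (transp 1 2) = transp 1 5 \<circ> transp 2 6 \<circ> transp 3 4 \<and>
     f (transp 2 3) = transp 1 2 \<circ> transp 3 5 \<circ> transp 4 6 \<and>
     f (transp 3 4) = transp 1 5 \<circ> transp 2 4 \<circ> transp 3 6 \<and>
     f (transp 4 5) = transp 1 4 \<circ> transp 2 6 \<circ> transp 3 5 \<and>
     f (transp 5 6) = transp 1 5 \<circ> transp 2 3 \<circ> transp 4 6"

lemma phi_spec_comp:
  assumes "phi_spec f" "bij g" "bij h"
  shows "f (g \<circ> h) = f g \<circ> f h"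
  using assms by (simp only: phi_spec_def auto_BijGroup_UNIV)

lemma phi_spec_unique:
  assumes "phi_spec f" "phi_spec f'"
  shows "f = f'"
proof
  fix g
  show "f g = f' g"
  proof (cases "bij g")
    case True
    then show ?thesis
    proof (induction rule: bij_adjacent_induct)
      case id
      \<comment> \<open>The image of \<open>id\<close> is an idempotent permutation, hence
        \<open>id\<close>.\<close>
      have fixes_id: "h id = id" if "phi_spec h" for h
      proof -
        have "bij (h id)" "h id \<circ> h id = h id"
          using that unfolding phi_spec_def auto_BijGroup_UNIV
          by (blast dest: bij_betwE intro: bij_id, metis bij_id comp_id)
        then show ?thesis
          by (metis bij_is_inj comp_assoc id_comp inv_o_cancel)
      qed
      then show ?case
        using assms by metis
    next
      case (transp a b g)
      have "f (transp a b) = f' (transp a b)"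
        using transp.hyps(1) assms by (auto simp: adjacent_def phi_spec_def)
      moreover have "h (transp a b \<circ> g) = h (transp a b) \<circ> h g" if "phi_spec h" for h
        using that transp.hyps(2) by (intro phi_spec_comp bij_transpose)
      ultimately show ?case
        using assms transp.IH by metis
    qed
  next
    \<comment> \<open>Off the carrier both maps are \<open>undefined\<close> by
      extensionality.\<close>
    case False
    then show ?thesis
      using assms by (auto simp: phi_spec_def auto_BijGroup_UNIV extensional_def)
  qed
qed

text \<open>The automorphism sends \<open>g\<close> to the permutation of indices that conjugation
  by \<open>g\<close> induces. Composition of intertwining pairs makes it multiplicative.\<close>

lemma phi_spec_exists: "\<exists>f. phi_spec f"
proof -
  define f where "f = (\<lambda>g\<in>{g. bij g}. THE h. intertwines g h)"
  have f_eq: "f g = h" if "bij g" "intertwines g h" for g h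
    using that intertwines_unique by (auto simp: f_def)
  have intertwines_f: "intertwines g (f g)" if "bij g" for g
    using that intertwines_total f_eq by metis
  have image: "f ` {g. bij g} = {g. bij g}"
  proof
    show "f ` {g. bij g} \<subseteq> {g. bij g}"
      using intertwines_f by (auto simp: intertwines_def)
    show "{g. bij g} \<subseteq> f ` {g. bij g}"
      using intertwines_surj f_eq by fastforce
  qed
  \<comment> \<open>Injectivity follows by counting, from surjectivity on a finite set.\<close>
  have "finite {g :: 6 \<Rightarrow> 6. bij g}"
    by simp
  then have "bij_betw f {g. bij g} {g. bij g}"
    using image by (simp add: bij_betw_def eq_card_imp_inj_on)
  moreover have "f (g \<circ> h) = f g \<circ> f h" if "bij g" "bij h" for g h
    using that by (intro f_eq bij_comp intertwines_comp intertwines_f)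
  moreover have "f \<in> extensional {g. bij g}"
    by (simp add: f_def)
  ultimately have "f \<in> auto (BijGroup UNIV)"
    by (simp add: auto_BijGroup_UNIV)
  then have "phi_spec f"
    unfolding phi_spec_def by (intro conjI f_eq bij_transpose intertwines_generators)
  then show ?thesis
    by blast
qed

lemma phi_spec_phi: "phi_spec phi"
proof -
  have "phi = (THE f. phi_spec f)"
    by (simp add: phi_def phi_spec_def)
  then show ?thesis
    using theI' [of phi_spec] phi_spec_exists phi_spec_unique by metis
qed

lemma bij_betw_phi: "bij_betw phi {g. bij g} {g. bij g}"
  and phi_comp: "bij g \<Longrightarrow> bij h \<Longrightarrow> phi (g \<circ> h) = phi g \<circ> phi h"
  and phi_transp_1_2: "phi (transp 1 2) = transp 1 5 \<circ> transp 2 6 \<circ> transp 3 4"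
  using phi_spec_phi by (auto simp: phi_spec_def auto_BijGroup_UNIV)

section \<open>Intersections and concurrent lines\<close>

definition triple :: "'k::field ^ 3 \<Rightarrow> 'k ^ 3 \<Rightarrow> 'k ^ 3 \<Rightarrow> 'k" where
  "triple a b c = det (vector [a, b, c])"

lemma triple_eq:
  "triple a b c = a $ 1 * b $ 2 * c $ 3 + a $ 2 * b $ 3 * c $ 1 + a $ 3 * b $ 1 * c $ 2
     - a $ 1 * b $ 3 * c $ 2 - a $ 2 * b $ 1 * c $ 3 - a $ 3 * b $ 2 * c $ 1"
  by (simp add: triple_def det_3)

lemma lin_form_eq: "lin_form a v = a $ 1 * v $ 1 + a $ 2 * v $ 2 + a $ 3 * v $ 3"
  by (simp add: lin_form_def sum_3)

text \<open>The linear dependence of four vectors in three-space, whose coefficients are signed 3 by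
  3 minors, evaluated at \<open>v\<close>.\<close>

lemma lin_form_relation:
  "triple b c d * lin_form a v - triple a c d * lin_form b v + triple a b d * lin_form c v
     - triple a b c * lin_form d v = 0"
  by (simp add: triple_eq lin_form_eq algebra_simps)

lemma lin_form_system:
  assumes "triple a b c \<noteq> 0"
  shows "\<exists>v. lin_form a v = p \<and> lin_form b v = q \<and> lin_form c v = r"
proof -
  \<comment> \<open>Cramer's rule before division: \<open>w\<close> combines the cross products of
    \<open>b, c\<close>, of \<open>c, a\<close> and of \<open>a, b\<close>, each killed by two of
    the three forms.\<close>
  define w :: "'a ^ 3" where "w = vector
    [p * (b $ 2 * c $ 3 - b $ 3 * c $ 2) + q * (c $ 2 * a $ 3 - c $ 3 * a $ 2) + r * (a $ 2 * b $ 3 - a $ 3 * b $ 2),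
     p * (b $ 3 * c $ 1 - b $ 1 * c $ 3) + q * (c $ 3 * a $ 1 - c $ 1 * a $ 3) + r * (a $ 3 * b $ 1 - a $ 1 * b $ 3),
     p * (b $ 1 * c $ 2 - b $ 2 * c $ 1) + q * (c $ 1 * a $ 2 - c $ 2 * a $ 1) + r * (a $ 1 * b $ 2 - a $ 2 * b $ 1)]"
  have w: "lin_form a w = triple a b c * p" "lin_form b w = triple a b c * q" "lin_form c w = triple a b c * r"
    by (simp_all add: w_def lin_form_eq triple_eq algebra_simps)
  have "lin_form u (inverse (triple a b c) *s w) = inverse (triple a b c) * lin_form u w" for u
    by (simp add: lin_form_eq algebra_simps)
  then show ?thesis
    using assms w by (intro exI [of _ "inverse (triple a b c) *s w"]) simp
qed

lemma lin_form_unique: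
  assumes "triple a b c \<noteq> 0"
    and "lin_form a v = lin_form a w" "lin_form b v = lin_form b w" "lin_form c v = lin_form c w"
  shows "v = w"
proof -
  have "triple a b c * u $ 1 = lin_form a u * (b $ 2 * c $ 3 - b $ 3 * c $ 2)
      + lin_form b u * (c $ 2 * a $ 3 - c $ 3 * a $ 2) + lin_form c u * (a $ 2 * b $ 3 - a $ 3 * b $ 2)"
    "triple a b c * u $ 2 = lin_form a u * (b $ 3 * c $ 1 - b $ 1 * c $ 3)
      + lin_form b u * (c $ 3 * a $ 1 - c $ 1 * a $ 3) + lin_form c u * (a $ 3 * b $ 1 - a $ 1 * b $ 3)"
    "triple a b c * u $ 3 = lin_form a u * (b $ 1 * c $ 2 - b $ 2 * c $ 1)
      + lin_form b u * (c $ 1 * a $ 2 - c $ 2 * a $ 1) + lin_form c u * (a $ 1 * b $ 2 - a $ 2 * b $ 1)" for u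
    by (simp_all add: lin_form_eq triple_eq algebra_simps)
  then have "triple a b c * v $ m = triple a b c * w $ m" for m
    using assms exhaust_3 [of m] by metis
  then show ?thesis
    using assms(1) by (simp add: vec_eq_iff)
qed

lemma triple_nonzero:
  assumes "generic_arrangement \<alpha>" "distinct [i, j, k]"
  shows "triple (\<alpha> i) (\<alpha> j) (\<alpha> k) \<noteq> 0"
proof
  assume "triple (\<alpha> i) (\<alpha> j) (\<alpha> k) = 0"
  define A where "A = (vector [\<alpha> i, \<alpha> j, \<alpha> k] :: 'a ^ 3 ^ 3)"
  have "\<not> invertible A"
    using \<open>triple _ _ _ = 0\<close> by (simp add: invertible_det_nz triple_def A_def)
  then obtain c m where c: "(\<Sum>l\<in>UNIV. c l *s row l A) = 0" "c m \<noteq> 0"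
    unfolding invertible_right_inverse matrix_right_invertible_independent_rows by blast
  have row: "row 1 A = \<alpha> i" "row 2 A = \<alpha> j" "row 3 A = \<alpha> k"
    by (simp_all add: A_def row_def vec_eq_iff)
  have "inj_on \<alpha> {i, j, k}" and indep: "vec.independent (\<alpha> ` {i, j, k})"
    using assms unfolding generic_arrangement_def by (metis card_3_iff distinct_length_2_or_more)+
  then have ne: "\<alpha> i \<noteq> \<alpha> j" "\<alpha> i \<noteq> \<alpha> k" "\<alpha> j \<noteq> \<alpha> k"
    using assms(2) by (auto simp: inj_on_def)
  \<comment> \<open>The dependence \<open>c\<close> is indexed by rows,
    \<open>vec.independent\<close> by vectors; \<open>u\<close> transfers the coefficients, which is
    sound as the three forms differ.\<close>
  define u where "u v = (if v = \<alpha> i then c 1 else if v = \<alpha> j then c 2 else c 3)" for v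
  have "(\<Sum>v\<in>\<alpha> ` {i, j, k}. u v *s v) = 0"
    using c(1) ne by (simp add: u_def sum_3 row add.assoc)
  then have "\<forall>v\<in>\<alpha> ` {i, j, k}. u v = 0"
    using indep by (subst (asm) vec.dependent_finite) auto
  then show False
    using c(2) ne exhaust_3 [of m] by (auto simp: u_def split: if_splits)
qed

lemma mem_D_iff: "x \<in> D \<alpha> L \<longleftrightarrow> (\<exists>v. \<forall>i\<in>L. lin_form (\<alpha> i) v = x $ i)"
  by (auto simp: D_def plane_def)

text \<open>Three of the planes meet in exactly one point; the equation says that the fourth passes
  through it, since the coefficient of \<open>x $ l\<close> is nonzero.\<close>

lemma mem_D_4_iff:
  assumes "generic_arrangement \<alpha>" "distinct [i, j, k, l]"
  shows "x \<in> D \<alpha> {i, j, k, l} \<longleftrightarrow>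
    triple (\<alpha> j) (\<alpha> k) (\<alpha> l) * x $ i - triple (\<alpha> i) (\<alpha> k) (\<alpha> l) * x $ j
    + triple (\<alpha> i) (\<alpha> j) (\<alpha> l) * x $ k - triple (\<alpha> i) (\<alpha> j) (\<alpha> k) * x $ l = 0"
    (is "_ \<longleftrightarrow> ?r = 0")
proof
  assume "x \<in> D \<alpha> {i, j, k, l}"
  then obtain v where "\<forall>m\<in>{i, j, k, l}. lin_form (\<alpha> m) v = x $ m"
    unfolding mem_D_iff by blast
  then show "?r = 0"
    using lin_form_relation [of "\<alpha> j" "\<alpha> k" "\<alpha> l" "\<alpha> i" v] by simp
next
  assume r: "?r = 0"
  have nz: "triple (\<alpha> i) (\<alpha> j) (\<alpha> k) \<noteq> 0"
    using assms by (intro triple_nonzero) auto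
  from lin_form_system [OF this] obtain v
    where v: "lin_form (\<alpha> i) v = x $ i" "lin_form (\<alpha> j) v = x $ j" "lin_form (\<alpha> k) v = x $ k"
    by blast
  have "triple (\<alpha> i) (\<alpha> j) (\<alpha> k) * lin_form (\<alpha> l) v = triple (\<alpha> i) (\<alpha> j) (\<alpha> k) * x $ l"
    using r lin_form_relation [of "\<alpha> j" "\<alpha> k" "\<alpha> l" "\<alpha> i" v]
    unfolding v right_minus_eq by metis
  then have "lin_form (\<alpha> l) v = x $ l"
    using nz mult_cancel_left by blast
  then show "x \<in> D \<alpha> {i, j, k, l}"
    using v unfolding mem_D_iff by blast
qed

section \<open>Translates with a common point\<close>

definition incidence :: "(6 \<Rightarrow> 'k::field ^ 3) \<Rightarrow> 'k ^ 3 \<Rightarrow> 'k ^ 6" where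
  "incidence \<alpha> v = (\<chi> i. lin_form (\<alpha> i) v)"

lemma incidence_nth [simp]: "incidence \<alpha> v $ i = lin_form (\<alpha> i) v"
  by (simp add: incidence_def)

lemma linear_incidence: "Vector_Spaces.linear (*s) (*s) (incidence \<alpha>)"
proof -
  have "incidence \<alpha> = (*v) (\<chi> i. \<alpha> i)"
    by (simp add: fun_eq_iff vec_eq_iff lin_form_def matrix_vector_mult_def)
  then show ?thesis
    by (metis matrix_vector_mul_linear_gen)
qed

text \<open>The translates all six of whose planes share a point, a subspace common to every
  \<open>D \<alpha> L\<close>.\<close>

definition central :: "(6 \<Rightarrow> 'k::field ^ 3) \<Rightarrow> ('k ^ 6) set" where
  "central \<alpha> = range (incidence \<alpha>)"

lemma subspace_central: "vec.subspace (central \<alpha>)"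
  unfolding central_def by (intro vec.linear_subspace_image linear_incidence vec.subspace_UNIV)

lemma dim_central:
  assumes "generic_arrangement \<alpha>"
  shows "vec.dim (central \<alpha>) = 3"
proof -
  have nz: "triple (\<alpha> 1) (\<alpha> 2) (\<alpha> 3) \<noteq> 0"
    using assms by (intro triple_nonzero) auto
  have "inj (incidence \<alpha>)"
    by (intro injI lin_form_unique [OF nz]; metis incidence_nth)
  then have "vec.dim (central \<alpha>) = vec.dim (UNIV :: ('a ^ 3) set)"
    unfolding central_def by (intro vec.dim_image_eq linear_incidence) (auto intro: inj_on_subset)
  then show ?thesis
    by (simp only: vec_dim_card) simp
qed

lemma central_subset_D: "central \<alpha> \<subseteq> D \<alpha> L"
  by (auto simp: central_def mem_D_iff)

lemma subspace_D: "vec.subspace (D \<alpha> L)"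
proof (rule vec.subspaceI)
  have add: "lin_form a (v + w) = lin_form a v + lin_form a w" for a v w :: "'a ^ 3"
    by (simp add: lin_form_eq algebra_simps)
  have scale: "lin_form a (c *s v) = c * lin_form a v" for a v :: "'a ^ 3" and c
    by (simp add: lin_form_eq algebra_simps)
  show "0 \<in> D \<alpha> L"
    unfolding mem_D_iff by (intro exI [of _ 0]) (simp add: lin_form_eq)
  show "x + y \<in> D \<alpha> L" if "x \<in> D \<alpha> L" "y \<in> D \<alpha> L" for x y
    using that unfolding mem_D_iff by (metis add vector_add_component)
  show "c *s x \<in> D \<alpha> L" if "x \<in> D \<alpha> L" for c x
    using that unfolding mem_D_iff by (metis scale vector_smult_component)
qed

text \<open>As \<open>central \<alpha>\<close> has dimension 3 in a six-dimensional space,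
  codimension below 3 amounts to containing it strictly.\<close>

lemma codim_less_3_iff:
  assumes "generic_arrangement \<alpha>" "vec.subspace X" "central \<alpha> \<subseteq> X"
  shows "codim X < 3 \<longleftrightarrow> X \<noteq> central \<alpha>"
proof -
  have "codim X < 3 \<longleftrightarrow> vec.dim X > 3"
    by (auto simp: codim_def)
  also have "\<dots> \<longleftrightarrow> X \<noteq> central \<alpha>"
  proof
    assume "X \<noteq> central \<alpha>"
    then have "\<not> vec.dim X \<le> vec.dim (central \<alpha>)"
      using assms subspace_central vec.subspace_dim_equal by blast
    then show "vec.dim X > 3"
      by (simp add: dim_central assms)
  qed (use dim_central [OF assms(1)] in auto)
  finally show ?thesis .
qed

text \<open>Fixed-point-free involutions of six points are the products of three disjoint
  transpositions; this form names no pairs.\<close>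

definition syntheme :: "(6 \<Rightarrow> 6) \<Rightarrow> bool" where
  "syntheme \<sigma> \<longleftrightarrow> (\<forall>x. \<sigma> (\<sigma> x) = x \<and> \<sigma> x \<noteq> x)"

text \<open>A syntheme \<open>\<sigma>\<close> corresponds to the \<open>3\<close>-set of the complements of its transposed pairs, whose
  intersection is \<open>isect \<alpha> \<sigma>\<close>.\<close>

definition isect :: "(6 \<Rightarrow> 'k::field ^ 3) \<Rightarrow> (6 \<Rightarrow> 6) \<Rightarrow> ('k ^ 6) set" where
  "isect \<alpha> \<sigma> = (\<Inter>y. D \<alpha> (- {y, \<sigma> y}))"

lemma codim_isect_less_3_iff:
  assumes "generic_arrangement \<alpha>"
  shows "codim (isect \<alpha> \<sigma>) < 3 \<longleftrightarrow> isect \<alpha> \<sigma> \<noteq> central \<alpha>"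
proof (rule codim_less_3_iff [OF assms])
  show "vec.subspace (isect \<alpha> \<sigma>)"
    unfolding isect_def by (rule vec.subspace_Inter) (auto intro: subspace_D)
  show "central \<alpha> \<subseteq> isect \<alpha> \<sigma>"
    using central_subset_D by (auto simp: isect_def)
qed

text \<open>A pair of \<open>\<tau>\<close> that crosses two pairs of \<open>\<sigma>\<close>
  supplies a point \<open>q\<close> that must equal the points supplied by \<open>\<sigma>\<close>
  for both of them. These two pairs are disjoint, so \<open>q\<close> lies on all six
  planes.\<close>

lemma isect_Int_subset_central:
  assumes \<alpha>: "generic_arrangement \<alpha>" and "syntheme \<sigma>" "syntheme \<tau>" "\<sigma> \<noteq> \<tau>"
  shows "isect \<alpha> \<sigma> \<inter> isect \<alpha> \<tau> \<subseteq> central \<alpha>"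
proof
  fix x
  assume x: "x \<in> isect \<alpha> \<sigma> \<inter> isect \<alpha> \<tau>"
  have "\<forall>y. \<exists>v. \<forall>i\<in>- {y, \<sigma> y}. lin_form (\<alpha> i) v = x $ i"
    using x by (simp add: isect_def mem_D_iff)
  \<comment> \<open>\<open>p y\<close> is a common point of the four planes outside the pair of
    \<open>y\<close>.\<close>
  then obtain p where p: "\<And>y i. i \<notin> {y, \<sigma> y} \<Longrightarrow> lin_form (\<alpha> i) (p y) = x $ i"
    by (metis ComplI)
  obtain y where y: "\<tau> y \<noteq> \<sigma> y"
    using assms(4) by fastforce
  define z where "z = \<tau> y"
  have \<sigma>: "\<sigma> (\<sigma> w) = w" "\<sigma> w \<noteq> w" for w
    using assms(2) by (auto simp: syntheme_def)
  have z: "z \<noteq> y" "z \<noteq> \<sigma> y"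
    using y assms(3) by (auto simp: syntheme_def z_def)
  then have \<sigma>z: "\<sigma> z \<noteq> y" "\<sigma> z \<noteq> \<sigma> y"
    using \<sigma> by metis+
  \<comment> \<open>\<open>u\<close> and \<open>\<sigma> u\<close> form the third pair of
    \<open>\<sigma>\<close>; its two planes contain \<open>p y\<close>, \<open>p z\<close> and
    \<open>q\<close>.\<close>
  obtain u where u: "u \<notin> {y, \<sigma> y, z, \<sigma> z}"
    using ex_notin_6 [of "[y, \<sigma> y, z, \<sigma> z]"] by auto
  have \<sigma>u: "\<sigma> u \<notin> {y, \<sigma> y, z, \<sigma> z}"
  proof
    assume "\<sigma> u \<in> {y, \<sigma> y, z, \<sigma> z}"
    then have "\<sigma> (\<sigma> u) \<in> \<sigma> ` {y, \<sigma> y, z, \<sigma> z}"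
      by (rule imageI)
    then show False
      using u unfolding image_insert image_empty \<sigma>(1) by blast
  qed
  have "x \<in> D \<alpha> (- {y, z})"
    using x unfolding isect_def z_def by blast
  then obtain q where q: "\<And>i. i \<notin> {y, z} \<Longrightarrow> lin_form (\<alpha> i) q = x $ i"
    unfolding mem_D_iff by (metis ComplI)
  have "p y = q"
  proof (rule lin_form_unique)
    show "triple (\<alpha> (\<sigma> z)) (\<alpha> u) (\<alpha> (\<sigma> u)) \<noteq> 0"
      using \<sigma>(2) [of u] \<sigma>z u \<sigma>u by (intro triple_nonzero \<alpha>) auto
  qed (use p [of _ y] q z \<sigma>(2) \<sigma>z u \<sigma>u in auto)
  moreover have "p z = q"
  proof (rule lin_form_unique)
    show "triple (\<alpha> (\<sigma> y)) (\<alpha> u) (\<alpha> (\<sigma> u)) \<noteq> 0"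
      using \<sigma>(2) [of u] \<sigma>z u \<sigma>u by (intro triple_nonzero \<alpha>) auto
  qed (use p [of _ z] q z \<sigma>(2) \<sigma>z u \<sigma>u in auto)
  moreover have "i \<notin> {y, \<sigma> y} \<or> i \<notin> {z, \<sigma> z}" for i
    using z \<sigma>z by auto
  ultimately have "lin_form (\<alpha> i) q = x $ i" for i
    using p by metis
  then have "x = incidence \<alpha> q"
    by (simp add: vec_eq_iff)
  then show "x \<in> central \<alpha>"
    by (simp add: central_def)
qed

text \<open>The bracket identity says that the lines \<open>ab\<close>, \<open>cd\<close>, \<open>ef\<close> through the six points \<open>\<alpha> i\<close> of the
  projective plane are concurrent.\<close>

lemma isect_ne_central_iff:
  assumes \<alpha>: "generic_arrangement \<alpha>" and \<sigma>: "syntheme \<sigma>" "\<sigma> a = b" "\<sigma> c = d" "\<sigma> e = f"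
    and dist: "distinct [a, b, c, d, e, f]"
  shows "isect \<alpha> \<sigma> \<noteq> central \<alpha> \<longleftrightarrow>
    triple (\<alpha> c) (\<alpha> d) (\<alpha> e) * triple (\<alpha> a) (\<alpha> b) (\<alpha> f) =
    triple (\<alpha> c) (\<alpha> d) (\<alpha> f) * triple (\<alpha> a) (\<alpha> b) (\<alpha> e)"
    (is "_ \<longleftrightarrow> ?cde * ?abf = ?cdf * ?abe")
proof -
  note U = UNIV_eq_6 [OF dist]
  have inv: "\<sigma> b = a" "\<sigma> d = c" "\<sigma> f = e"
    using \<sigma> by (auto simp: syntheme_def)
  have "- {a, b} = {c, d, e, f}" "- {c, d} = {a, b, e, f}" "- {e, f} = {a, b, c, d}"
    using dist by (auto simp: Compl_eq_Diff_UNIV U)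
  then have isect: "isect \<alpha> \<sigma> = D \<alpha> {c, d, e, f} \<inter> D \<alpha> {a, b, e, f} \<inter> D \<alpha> {a, b, c, d}"
    using \<sigma> inv by (auto simp: isect_def U insert_commute)
  have nz: "?cde \<noteq> 0" "?abe \<noteq> 0" "?cdf \<noteq> 0" "?abf \<noteq> 0" "triple (\<alpha> a) (\<alpha> b) (\<alpha> c) \<noteq> 0"
    by (rule triple_nonzero [OF \<alpha>]; use dist in auto)+
  show ?thesis
  proof
    assume "isect \<alpha> \<sigma> \<noteq> central \<alpha>"
    then obtain x where x: "x \<in> isect \<alpha> \<sigma>" "x \<notin> central \<alpha>"
      using central_subset_D [of \<alpha>] unfolding isect_def by blast
    then have "x \<in> D \<alpha> {a, b, c, d}"
      by (simp add: isect)
    then obtain v where v: "\<And>i. i \<in> {a, b, c, d} \<Longrightarrow> lin_form (\<alpha> i) v = x $ i"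
      unfolding mem_D_iff by blast
    \<comment> \<open>Subtracting a central translate makes four coordinates vanish and leaves two
      homogeneous equations in the other two.\<close>
    define y where "y = x - incidence \<alpha> v"
    have "incidence \<alpha> v \<in> isect \<alpha> \<sigma>"
      using central_subset_D [of \<alpha>] unfolding isect_def central_def by blast
    then have "y \<in> isect \<alpha> \<sigma>"
      unfolding y_def isect using x(1)
      by (simp add: isect vec.subspace_diff subspace_D)
    moreover have y0: "y $ a = 0" "y $ b = 0" "y $ c = 0" "y $ d = 0"
      using v by (simp_all add: y_def)
    ultimately have eqs: "?cdf * y $ e = ?cde * y $ f" "?abf * y $ e = ?abe * y $ f"
      using dist by (auto simp: isect mem_D_4_iff [OF \<alpha>])
    have "y $ f \<noteq> 0"
    proof
      assume f: "y $ f = 0"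
      then have "y $ e = 0"
        using eqs nz by simp
      then have "y $ i = 0" for i
        using U y0 f by (metis UNIV_I empty_iff insert_iff)
      then have "x = incidence \<alpha> v"
        by (simp add: y_def vec_eq_iff)
      then show False
        using x(2) by (simp add: central_def)
    qed
    have "?cde * ?abf * y $ f = ?abf * (?cde * y $ f)"
      by simp
    also have "\<dots> = ?cdf * (?abf * y $ e)"
      unfolding eqs(1) [symmetric] by simp
    also have "\<dots> = ?cdf * ?abe * y $ f"
      unfolding eqs(2) by simp
    finally show "?cde * ?abf = ?cdf * ?abe"
      using \<open>y $ f \<noteq> 0\<close> by simp
  next
    assume eq: "?cde * ?abf = ?cdf * ?abe"
    \<comment> \<open>These entries solve the equation of \<open>D \<alpha> {a, b, e, f}\<close>;
      the bracket identity is then the equation of \<open>D \<alpha> {c, d, e, f}\<close>.\<close>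
    define x where "x = (\<chi> i. if i = e then ?abe else if i = f then ?abf else 0)"
    have "x \<in> isect \<alpha> \<sigma>"
      using dist eq by (auto simp: isect mem_D_4_iff [OF \<alpha>] x_def)
    moreover have "x \<notin> central \<alpha>"
    proof
      assume "x \<in> central \<alpha>"
      then obtain v where v: "x = incidence \<alpha> v"
        by (auto simp: central_def)
      have zero: "lin_form u 0 = 0" for u :: "'a ^ 3"
        by (simp add: lin_form_eq)
      have "lin_form (\<alpha> i) v = 0" if "i \<in> {a, b, c}" for i
      proof -
        have "lin_form (\<alpha> i) v = x $ i"
          by (simp add: v)
        then show ?thesis
          using that dist by (auto simp: x_def)
      qed
      then have "v = 0"
        by (intro lin_form_unique [OF nz(5)]) (simp_all add: zero)
      then have "x $ e = 0"
        by (simp add: v zero)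
      then show False
        using nz by (simp add: x_def)
    qed
    ultimately show "isect \<alpha> \<sigma> \<noteq> central \<alpha>"
      by blast
  qed
qed

text \<open>Pappus's theorem: expanded as below, the bracket identities of \<open>\<sigma>\<close> and \<open>\<tau>\<close> share a side, and
  equating the other two sides gives that of \<open>\<rho>\<close>.\<close>

lemma isect_pappus:
  assumes \<alpha>: "generic_arrangement \<alpha>" and syntheme: "syntheme \<sigma>" "syntheme \<tau>" "syntheme \<rho>"
    and dist: "distinct [a, b, c, d, e, f]"
    and \<sigma>: "\<sigma> a = b" "\<sigma> c = d" "\<sigma> e = f" and \<tau>: "\<tau> b = c" "\<tau> d = e" "\<tau> f = a"
    and \<rho>: "\<rho> a = d" "\<rho> c = f" "\<rho> e = b"
    and deg: "isect \<alpha> \<sigma> \<noteq> central \<alpha>" "isect \<alpha> \<tau> \<noteq> central \<alpha>"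
  shows "isect \<alpha> \<rho> \<noteq> central \<alpha>"
proof -
  have inv: "\<tau> e = d" "\<rho> f = c"
    using syntheme \<tau>(2) \<rho>(2) by (auto simp: syntheme_def)
  \<comment> \<open>The pair split between the brackets is \<open>ab\<close> here, \<open>ed\<close>
    for \<open>\<tau>\<close> and \<open>fc\<close> for \<open>\<rho>\<close>, so that the same
    brackets recur up to sign.\<close>
  have "isect \<alpha> \<sigma> \<noteq> central \<alpha> \<longleftrightarrow>
    triple (\<alpha> e) (\<alpha> f) (\<alpha> a) * triple (\<alpha> c) (\<alpha> d) (\<alpha> b) =
    triple (\<alpha> e) (\<alpha> f) (\<alpha> b) * triple (\<alpha> c) (\<alpha> d) (\<alpha> a)"
    by (rule isect_ne_central_iff [OF \<alpha>]; (fact | use dist in auto)+)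
  moreover have "isect \<alpha> \<tau> \<noteq> central \<alpha> \<longleftrightarrow>
    triple (\<alpha> b) (\<alpha> c) (\<alpha> e) * triple (\<alpha> f) (\<alpha> a) (\<alpha> d) =
    triple (\<alpha> b) (\<alpha> c) (\<alpha> d) * triple (\<alpha> f) (\<alpha> a) (\<alpha> e)"
    by (rule isect_ne_central_iff [OF \<alpha>]; (fact | use dist in auto)+)
  moreover have "isect \<alpha> \<rho> \<noteq> central \<alpha> \<longleftrightarrow>
    triple (\<alpha> a) (\<alpha> d) (\<alpha> f) * triple (\<alpha> e) (\<alpha> b) (\<alpha> c) =
    triple (\<alpha> a) (\<alpha> d) (\<alpha> c) * triple (\<alpha> e) (\<alpha> b) (\<alpha> f)"
    by (rule isect_ne_central_iff [OF \<alpha>]; (fact | use dist in auto)+)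
  moreover have "triple (\<alpha> c) (\<alpha> d) (\<alpha> b) = triple (\<alpha> b) (\<alpha> c) (\<alpha> d)"
    "triple (\<alpha> f) (\<alpha> a) (\<alpha> e) = triple (\<alpha> e) (\<alpha> f) (\<alpha> a)"
    "triple (\<alpha> a) (\<alpha> d) (\<alpha> f) = triple (\<alpha> f) (\<alpha> a) (\<alpha> d)"
    "triple (\<alpha> e) (\<alpha> b) (\<alpha> c) = triple (\<alpha> b) (\<alpha> c) (\<alpha> e)"
    "triple (\<alpha> a) (\<alpha> d) (\<alpha> c) = - triple (\<alpha> c) (\<alpha> d) (\<alpha> a)"
    "triple (\<alpha> e) (\<alpha> b) (\<alpha> f) = - triple (\<alpha> e) (\<alpha> f) (\<alpha> b)"
    by (simp_all add: triple_eq)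
  ultimately show ?thesis
    using deg by (simp add: mult.commute)
qed

section \<open>Degenerate synthemes\<close>

lemma syntheme_pairs:
  assumes "syntheme \<sigma>"
  obtains a c e where "distinct [a, \<sigma> a, c, \<sigma> c, e, \<sigma> e]"
proof -
  have \<sigma>: "\<sigma> (\<sigma> x) = x" "\<sigma> x \<noteq> x" for x
    using assms by (auto simp: syntheme_def)
  have new: "\<sigma> y \<notin> {x, \<sigma> x}" if "y \<notin> {x, \<sigma> x}" for x y
    using that \<sigma>(1) by (metis insert_iff singletonD)
  obtain c where c: "c \<notin> {1, \<sigma> 1}"
    using ex_notin_6 [of "[1, \<sigma> 1]"] by auto
  obtain e where "e \<notin> {1, \<sigma> 1, c, \<sigma> c}"
    using ex_notin_6 [of "[1, \<sigma> 1, c, \<sigma> c]"] by auto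
  then have "distinct [1, \<sigma> 1, c, \<sigma> c, e, \<sigma> e]"
    using c new [of c 1] new [of e 1] new [of e c] \<sigma>(2) [of 1] \<sigma>(2) [of c] \<sigma>(2) [of e] by auto
  then show ?thesis
    by (rule that)
qed

text \<open>Each member of the 3-set misses exactly one transposed pair. The range hits each
  complement twice, once for each point of the pair.\<close>

lemma corresponds_iff:
  "corresponds \<sigma> T \<longleftrightarrow> syntheme \<sigma> \<and> T = range (\<lambda>y. - {y, \<sigma> y})"
proof
  assume "corresponds \<sigma> T"
  then obtain a b c d e f where U: "{a, b, c, d, e, f} = UNIV"
    and \<sigma>: "\<sigma> = transp a b \<circ> transp c d \<circ> transp e f"
    and T: "T = {{a, b, c, d}, {c, d, e, f}, {a, b, e, f}}"
    unfolding corresponds_def by blast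
  \<comment> \<open>A list of six entries that exhausts a six-element type has no
    repetition.\<close>
  have "card (set [a, b, c, d, e, f]) = length [a, b, c, d, e, f]"
    using U by simp
  then have dist: "distinct [a, b, c, d, e, f]"
    by (rule card_distinct)
  then have vals: "\<sigma> a = b" "\<sigma> b = a" "\<sigma> c = d" "\<sigma> d = c" "\<sigma> e = f" "\<sigma> f = e"
    by (auto simp: \<sigma>)
  have all: "(\<forall>x. Q x) \<longleftrightarrow> Q a \<and> Q b \<and> Q c \<and> Q d \<and> Q e \<and> Q f" for Q
    using U by (metis UNIV_I empty_iff insert_iff)
  have "syntheme \<sigma>"
    unfolding syntheme_def all using dist by (auto simp: vals)
  moreover have "- {a, b} = {c, d, e, f}" "- {c, d} = {a, b, e, f}" "- {e, f} = {a, b, c, d}"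
    using dist by (auto simp: Compl_eq_Diff_UNIV simp flip: U)
  then have "range (\<lambda>y. - {y, \<sigma> y}) = T"
    unfolding T by (simp add: vals insert_commute flip: U)
  ultimately show "syntheme \<sigma> \<and> T = range (\<lambda>y. - {y, \<sigma> y})"
    by simp
next
  assume *: "syntheme \<sigma> \<and> T = range (\<lambda>y. - {y, \<sigma> y})"
  then obtain a c e where dist: "distinct [a, \<sigma> a, c, \<sigma> c, e, \<sigma> e]"
    using syntheme_pairs by blast
  note U = UNIV_eq_6 [OF dist]
  have inv: "\<sigma> (\<sigma> x) = x" for x
    using * by (simp add: syntheme_def)
  have all: "(\<forall>x. Q x) \<longleftrightarrow> Q a \<and> Q (\<sigma> a) \<and> Q c \<and> Q (\<sigma> c) \<and> Q e \<and> Q (\<sigma> e)" for Q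
    using U by (metis UNIV_I empty_iff insert_iff)
  have \<sigma>: "\<sigma> = transp a (\<sigma> a) \<circ> transp c (\<sigma> c) \<circ> transp e (\<sigma> e)"
    unfolding fun_eq_iff all using dist by (auto simp: inv)
  have "- {a, \<sigma> a} = {c, \<sigma> c, e, \<sigma> e}" "- {c, \<sigma> c} = {a, \<sigma> a, e, \<sigma> e}"
    "- {e, \<sigma> e} = {a, \<sigma> a, c, \<sigma> c}"
    using dist by (auto simp: Compl_eq_Diff_UNIV U)
  then have range: "range (\<lambda>y. - {y, \<sigma> y}) =
      {{a, \<sigma> a, c, \<sigma> c}, {c, \<sigma> c, e, \<sigma> e}, {a, \<sigma> a, e, \<sigma> e}}"
    by (simp add: U inv insert_commute)
  show "corresponds \<sigma> T"
    unfolding corresponds_def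
    by (intro exI conjI) (rule U [symmetric], rule \<sigma>, rule trans [OF conjunct2 [OF *] range])
qed

lemma syntheme_conj:
  assumes "syntheme \<sigma>" "bij g" "\<tau> \<circ> g = g \<circ> \<sigma>"
  shows "syntheme \<tau>"
proof -
  have "\<tau> (\<tau> y) = y \<and> \<tau> y \<noteq> y" for y
  proof -
    obtain x where "y = g x"
      using assms(2) by (metis bij_pointE)
    moreover have "\<tau> (g x) = g (\<sigma> x)" for x
      using assms(3) by (simp add: fun_eq_iff)
    ultimately show ?thesis
      using assms(1,2) by (auto simp: syntheme_def dest: bij_is_inj injD)
  qed
  then show ?thesis
    by (simp add: syntheme_def)
qed

lemma transp_conj:
  assumes "bij h"
  shows "transp (h a) (h b) \<circ> h = h \<circ> transp a b"
  using assms by (simp add: transpose_comp_eq bij_is_inj)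

lemma phi_transp_conj:
  assumes "bij h"
  shows "phi (transp (h a) (h b)) \<circ> phi h = phi h \<circ> phi (transp a b)"
  using transp_conj [OF assms] assms bij_transpose by (metis phi_comp)

lemma bij_phi: "bij g \<Longrightarrow> bij (phi g)"
  using bij_betw_phi bij_betwE by blast

lemma syntheme_phi_1_2: "syntheme (phi (transp 1 2))"
  unfolding syntheme_def all_6 phi_transp_1_2 by simp

text \<open>All transpositions are conjugate to \<open>transp 1 2\<close>, so their images are
  conjugate to the syntheme \<open>phi (transp 1 2)\<close>.\<close>

lemma syntheme_phi_transp:
  assumes "i \<noteq> j"
  shows "syntheme (phi (transp i j))"
proof -
  \<comment> \<open>The right factor moves 1 to \<open>i\<close>; the left one corrects the image of
    2 to \<open>j\<close> without disturbing \<open>i\<close>.\<close>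
  define h where "h = transp (transp 1 i 2) j \<circ> transp 1 i"
  have h: "bij h"
    by (simp add: h_def bij_comp)
  have "transp 1 i 2 \<noteq> i"
    by (simp add: transpose_eq_iff)
  then have "h 1 = i" "h 2 = j"
    using assms by (simp_all add: h_def)
  then show ?thesis
    using syntheme_conj [OF syntheme_phi_1_2 bij_phi [OF h]] phi_transp_conj [OF h, of 1 2] by simp
qed

text \<open>Any two synthemes are conjugate. Writing the conjugating permutation as
  \<open>phi h\<close> turns \<open>\<tau>\<close> into the image of the transposition of
  \<open>h 1\<close> and \<open>h 2\<close>.\<close>

lemma syntheme_imp_phi_transp:
  assumes "syntheme \<tau>"
  obtains i j where "i \<noteq> j" "\<tau> = phi (transp i j)"
proof -
  define \<sigma> where "\<sigma> = phi (transp 1 2)"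
  obtain a c e where dist: "distinct [a, \<tau> a, c, \<tau> c, e, \<tau> e]"
    using syntheme_pairs [OF assms] by blast
  \<comment> \<open>\<open>g\<close> carries the pairs 15, 26, 34 of \<open>phi (transp 1 2)\<close>
    to the pairs of \<open>\<tau>\<close>.\<close>
  define g where "g x = (if x = 1 then a else if x = 5 then \<tau> a else if x = 2 then c
    else if x = 6 then \<tau> c else if x = 3 then e else \<tau> e)" for x :: 6
  have "range g = {g 1, g 5, g 2, g 6, g 3, g 4}"
    unfolding UNIV_6 by (simp add: insert_commute)
  also have "\<dots> = UNIV"
    unfolding UNIV_eq_6 [OF dist] by (simp add: g_def)
  finally have g: "bij g"
    by (simp add: bij_def finite_UNIV_surj_inj)
  have "\<tau> (\<tau> x) = x" for x
    using assms by (simp add: syntheme_def)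
  then have conj: "\<tau> \<circ> g = g \<circ> \<sigma>"
    unfolding fun_eq_6 \<sigma>_def phi_transp_1_2 by (simp add: g_def)
  have "g \<in> phi ` {g. bij g}"
    using g by (simp add: bij_betw_imp_surj_on [OF bij_betw_phi])
  then obtain h where h: "bij h" "g = phi h"
    by blast
  have "\<tau> \<circ> phi h = phi (transp (h 1) (h 2)) \<circ> phi h"
    using conj phi_transp_conj [OF h(1), of 1 2] by (simp add: h(2) \<sigma>_def)
  then have "\<tau> = phi (transp (h 1) (h 2))"
    using bij_phi [OF h(1)] by (metis bij_is_surj comp_assoc comp_id surj_iff)
  moreover have "h 1 \<noteq> h 2"
    using h(1) by (simp add: bij_is_inj inj_eq)
  ultimately show ?thesis
    using that by blast
qed

text \<open>The two points moved by the preimage under \<open>\<phi>\<close>.\<close>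

definition support :: "(6 \<Rightarrow> 6) \<Rightarrow> 6 set" where
  "support \<sigma> = {x. inv_into {g. bij g} phi \<sigma> x \<noteq> x}"

lemma support_phi_transp:
  assumes "i \<noteq> j"
  shows "support (phi (transp i j)) = {i, j}"
proof -
  have "inv_into {g. bij g} phi (phi (transp i j)) = transp i j"
    using bij_betw_phi by (intro inv_into_f_f) (auto simp: bij_betw_def)
  then show ?thesis
    using assms by (auto simp: support_def transpose_eq_iff)
qed

lemma phi_transp_eqD:
  assumes "phi (transp i j) = phi (transp k l)" "i \<noteq> j" "k \<noteq> l"
  shows "{i, j} = {k, l}"
  using assms support_phi_transp by metis

text \<open>Synthemes sharing a pair commute on the other four points.\<close>

lemma braid_imp_disjoint:
  assumes "syntheme s" "syntheme t" "s \<noteq> t" and braid: "s \<circ> t \<circ> s = t \<circ> s \<circ> t"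
  shows "s x \<noteq> t x"
proof
  assume eq: "s x = t x"
  have inv: "s (s u) = u" "t (t u) = u" "s u \<noteq> u" "t u \<noteq> u" for u
    using assms(1,2) by (auto simp: syntheme_def)
  obtain u where u: "s u \<noteq> t u"
    using assms(3) by (auto simp: fun_eq_iff)
  have ux: "u \<noteq> x" "u \<noteq> s x"
    using u eq inv by metis+
  have dist: "distinct [x, s x, u, s u, t u]"
    using u ux eq inv by simp metis
  \<comment> \<open>Both points avoid the same five, so both are the sixth point. Hence
    \<open>s\<close> and \<open>t\<close> commute at \<open>u\<close>, and the braid relation
    collapses to \<open>t u = s u\<close>.\<close>
  have notin: "s (t u) \<notin> {x, s x, u, s u, t u}" "t (s u) \<notin> {x, s x, u, s u, t u}"
    using u ux eq inv by simp_all metis+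
  then have "distinct [x, s x, u, s u, t u, s (t u)]"
    using dist by auto
  from UNIV_eq_6 [OF this] have "t (s u) \<in> {x, s x, u, s u, t u, s (t u)}"
    by blast
  then have "s (t u) = t (s u)"
    using notin(2) unfolding insert_iff empty_iff by metis
  then have "t u = (s \<circ> t \<circ> s) u" "s u = (t \<circ> s \<circ> t) u"
    using inv by (metis comp_apply)+
  then show False
    using braid u by simp
qed

lemma isect_ne_central_trans:
  assumes \<alpha>: "generic_arrangement \<alpha>" and dist: "distinct [i, j, k]"
    and deg: "isect \<alpha> (phi (transp i j)) \<noteq> central \<alpha>" "isect \<alpha> (phi (transp j k)) \<noteq> central \<alpha>"
  shows "isect \<alpha> (phi (transp i k)) \<noteq> central \<alpha>"
proof -
  define s t r where "s = phi (transp i j)" and "t = phi (transp j k)" and "r = phi (transp i k)"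
  have syntheme: "syntheme s" "syntheme t" "syntheme r"
    using dist by (simp_all add: s_def t_def r_def syntheme_phi_transp)
  have inv: "s (s u) = u" "t (t u) = u" "s u \<noteq> u" "t u \<noteq> u" "r (r u) = u" "r u \<noteq> u" for u
    using syntheme by (auto simp: syntheme_def)
  \<comment> \<open>Conjugating either transposition by the other gives \<open>transp i k\<close>;
    \<open>phi\<close> carries over both expressions.\<close>
  have "transp i k = transp i j \<circ> transp j k \<circ> transp i j"
    using dist by (simp add: transpose_comp_triple)
  then have sts: "r = s \<circ> t \<circ> s"
    by (simp add: r_def s_def t_def phi_comp bij_comp)
  have "k \<noteq> i" "j \<noteq> i"
    using dist by auto
  from transpose_comp_triple [OF this] have "transp i k = transp j k \<circ> transp i j \<circ> transp j k"
    by (simp add: transpose_commute)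
  then have tst: "r = t \<circ> s \<circ> t"
    by (simp add: r_def s_def t_def phi_comp bij_comp)
  have r: "r u = s (t (s u))" "r u = t (s (t u))" for u
    by (simp add: sts) (simp add: tst)
  have "s \<noteq> t"
    using dist phi_transp_eqD [of i j j k] by (auto simp: s_def t_def doubleton_eq_iff)
  then have ne: "s u \<noteq> t u" for u
    using braid_imp_disjoint syntheme sts tst by metis
  \<comment> \<open>The two disjoint synthemes form a hexagon, whose long diagonals are the third one.\<close>
  define a :: 6 where "a = 1"
  define b c d e f where "b = s a" and "c = t b" and "d = s c" and "e = t d" and "f = s e"
  have st: "s a = b" "s b = a" "t b = c" "t c = b" "s c = d" "s d = c" "t d = e" "t e = d" "s e = f" "s f = e"
    by (simp_all add: inv b_def c_def d_def e_def f_def)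
  have rs: "r a = d" "r b = e" "r c = f" "r d = a" "r e = b" "r f = c"
    using r st inv by metis+
  \<comment> \<open>The hexagon closes: \<open>r f = c\<close> read as
    \<open>t (s (t f)) = c\<close> unwinds to \<open>t f = a\<close>.\<close>
  have fa: "t f = a" "t a = f"
    using r st inv rs by metis+
  have "distinct [a, b, c, d, e, f]"
    using inv ne st rs fa by simp metis
  from isect_pappus [OF \<alpha> syntheme this st(1,5,9,3,7) fa(1) rs(1,3,5)] show ?thesis
    using deg by (simp add: s_def t_def r_def)
qed

section \<open>Non-very generic intersections as edge sets of partitions\<close>

lemma nonvery_generic_eq:
  assumes "generic_arrangement \<alpha>"
  shows "nonvery_generic \<alpha> = isect \<alpha> ` {\<sigma>. syntheme \<sigma> \<and> isect \<alpha> \<sigma> \<noteq> central \<alpha>}"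
proof -
  have "(\<Inter>L\<in>range (\<lambda>y. - {y, \<sigma> y}). D \<alpha> L) = isect \<alpha> \<sigma>" for \<sigma>
    by (simp add: isect_def image_image)
  then show ?thesis
    unfolding nonvery_generic_def corresponds_iff
    using codim_isect_less_3_iff [OF assms] by auto
qed

lemma phi_edges_syntheme: "\<sigma> \<in> phi_edges P \<Longrightarrow> syntheme \<sigma>"
  by (auto simp: phi_edges_def syntheme_phi_transp)

lemma corresponds_phi_edges_eq:
  "{\<Inter>L\<in>T. D \<alpha> L | T. \<exists>\<sigma>\<in>phi_edges P. corresponds \<sigma> T} = isect \<alpha> ` phi_edges P"
proof -
  have isect: "(\<Inter>L\<in>range (\<lambda>y. - {y, \<sigma> y}). D \<alpha> L) = isect \<alpha> \<sigma>" for \<sigma>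
    by (simp add: isect_def image_image)
  have "{\<Inter>L\<in>T. D \<alpha> L | T. \<exists>\<sigma>\<in>phi_edges P. corresponds \<sigma> T} =
      {\<Inter>L\<in>range (\<lambda>y. - {y, \<sigma> y}). D \<alpha> L | \<sigma>. \<sigma> \<in> phi_edges P}"
    unfolding corresponds_iff using phi_edges_syntheme by blast
  also have "\<dots> = isect \<alpha> ` phi_edges P"
    unfolding isect by blast
  finally show ?thesis .
qed

text \<open>If the synthemes differed, the shared intersection would lie in
  \<open>central \<alpha>\<close>.\<close>

lemma isect_inj:
  assumes "generic_arrangement \<alpha>" "syntheme \<sigma>" "syntheme \<tau>" "isect \<alpha> \<sigma> = isect \<alpha> \<tau>"
    "isect \<alpha> \<sigma> \<noteq> central \<alpha>"
  shows "\<sigma> = \<tau>"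
proof (rule ccontr)
  assume "\<sigma> \<noteq> \<tau>"
  then have "isect \<alpha> \<sigma> \<subseteq> central \<alpha>"
    using isect_Int_subset_central [OF assms(1-3)] assms(4) by simp
  moreover have "central \<alpha> \<subseteq> isect \<alpha> \<sigma>"
    using central_subset_D by (auto simp: isect_def)
  ultimately show False
    using assms(5) by blast
qed

text \<open>This passes from subspaces to synthemes. All nondegenerate synthemes give
  \<open>central \<alpha>\<close>, so injectivity of \<open>isect \<alpha>\<close> is available only
  once degeneracy is known.\<close>

lemma nonvery_generic_eq_iff:
  assumes "generic_arrangement \<alpha>"
  shows "nonvery_generic \<alpha> = {\<Inter>L\<in>T. D \<alpha> L | T. \<exists>\<sigma>\<in>phi_edges P. corresponds \<sigma> T} \<longleftrightarrow>
    phi_edges P = {\<sigma>. syntheme \<sigma> \<and> isect \<alpha> \<sigma> \<noteq> central \<alpha>}"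
    (is "?l \<longleftrightarrow> _ = ?E")
proof
  assume ?l
  then have eq: "isect \<alpha> ` ?E = isect \<alpha> ` phi_edges P"
    by (simp only: nonvery_generic_eq [OF assms] corresponds_phi_edges_eq)
  show "phi_edges P = ?E"
  proof (intro equalityI subsetI)
    fix \<sigma>
    assume "\<sigma> \<in> phi_edges P"
    \<comment> \<open>No member of this image is \<open>central \<alpha>\<close>, so the edge is
      degenerate.\<close>
    moreover from this have "isect \<alpha> \<sigma> \<in> isect \<alpha> ` ?E"
      unfolding eq by (rule imageI)
    ultimately show "\<sigma> \<in> ?E"
      using phi_edges_syntheme by auto
  next
    fix \<sigma>
    assume \<sigma>: "\<sigma> \<in> ?E"
    then have "isect \<alpha> \<sigma> \<in> isect \<alpha> ` phi_edges P"
      unfolding eq [symmetric] by (rule imageI)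
    then obtain \<tau> where "\<tau> \<in> phi_edges P" "isect \<alpha> \<sigma> = isect \<alpha> \<tau>"
      by blast
    then show "\<sigma> \<in> phi_edges P"
      using isect_inj [OF assms, of \<sigma> \<tau>] phi_edges_syntheme \<sigma> by auto
  qed
next
  assume "phi_edges P = ?E"
  then show ?l
    unfolding nonvery_generic_eq [OF assms] corresponds_phi_edges_eq by simp
qed

lemma phi_transp_mem_phi_edges_iff:
  assumes "i \<noteq> j"
  shows "phi (transp i j) \<in> phi_edges P \<longleftrightarrow> (\<exists>B\<in>P. i \<in> B \<and> j \<in> B)"
proof
  assume "phi (transp i j) \<in> phi_edges P"
  then obtain k l B where *: "phi (transp i j) = phi (transp k l)" "k \<noteq> l" "B \<in> P" "k \<in> B" "l \<in> B"
    unfolding phi_edges_def by blast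
  then have eq: "{i, j} = {k, l}"
    using phi_transp_eqD assms by blast
  have "{i, j} \<subseteq> B"
    unfolding eq using *(4,5) by simp
  then show "\<exists>B\<in>P. i \<in> B \<and> j \<in> B"
    using *(3) by auto
qed (use assms in \<open>auto simp: phi_edges_def\<close>)

text \<open>A partition is the quotient by its relation of sharing a block. The edges determine this
  relation off the diagonal, and on the diagonal it always holds.\<close>

lemma phi_edges_inj:
  assumes "partition_on UNIV P" "partition_on UNIV Q" "phi_edges P = phi_edges Q"
  shows "P = Q"
proof -
  have eq: "(\<exists>B\<in>P. i \<in> B \<and> j \<in> B) \<longleftrightarrow> (\<exists>B\<in>Q. i \<in> B \<and> j \<in> B)" for i j
  proof (cases "i = j")
    case True
    then show ?thesis
      using assms(1,2) by (metis UNIV_I UnionE partition_onD1)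
  next
    case False
    show ?thesis
      using assms(3) unfolding phi_transp_mem_phi_edges_iff [OF False, symmetric] by simp
  qed
  have "UNIV // {(i, j). \<exists>B\<in>P. i \<in> B \<and> j \<in> B} = UNIV // {(i, j). \<exists>B\<in>Q. i \<in> B \<and> j \<in> B}"
    unfolding eq ..
  then show ?thesis
    by (simp only: partition_on_eq_quotient assms(1,2))
qed

lemma ex_partition_phi_edges:
  assumes \<alpha>: "generic_arrangement \<alpha>"
  shows "\<exists>P. partition_on UNIV P \<and> phi_edges P = {\<sigma>. syntheme \<sigma> \<and> isect \<alpha> \<sigma> \<noteq> central \<alpha>}"
proof -
  \<comment> \<open>The diagonal is added by hand, since \<open>transp i i\<close> is the identity
    and gives no edge.\<close>
  define R where "R = {(i, j). i = j \<or> isect \<alpha> (phi (transp i j)) \<noteq> central \<alpha>}"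
  have equiv: "equiv UNIV R"
  proof (rule equivI)
    show "sym R"
      by (auto simp: sym_def R_def transpose_commute)
    show "trans R"
    proof (rule transI)
      fix i j k
      assume R: "(i, j) \<in> R" "(j, k) \<in> R"
      show "(i, k) \<in> R"
      proof (cases "distinct [i, j, k]")
        case True
        then show ?thesis
          using R isect_ne_central_trans [OF \<alpha> True] by (simp add: R_def)
      next
        case False
        then have "i = j \<or> j = k \<or> i = k"
          by auto
        moreover have "(i, i) \<in> R"
          by (simp add: R_def)
        ultimately show ?thesis
          using R by blast
      qed
    qed
  qed (auto simp: refl_on_def R_def)
  have block: "(\<exists>B\<in>UNIV // R. i \<in> B \<and> j \<in> B) \<longleftrightarrow> (i, j) \<in> R" for i j
  proof
    assume "\<exists>B\<in>UNIV // R. i \<in> B \<and> j \<in> B"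
    then show "(i, j) \<in> R"
      using in_quotient_imp_in_rel [OF equiv] by blast
  next
    assume "(i, j) \<in> R"
    moreover have "(i, i) \<in> R"
      by (simp add: R_def)
    ultimately have "i \<in> R `` {i} \<and> j \<in> R `` {i}"
      by simp
    then show "\<exists>B\<in>UNIV // R. i \<in> B \<and> j \<in> B"
      by (rule bexI [OF _ quotientI [OF UNIV_I]])
  qed
  have "phi_edges (UNIV // R) = {\<sigma>. syntheme \<sigma> \<and> isect \<alpha> \<sigma> \<noteq> central \<alpha>}"
  proof (intro equalityI subsetI)
    fix \<sigma>
    assume "\<sigma> \<in> phi_edges (UNIV // R)"
    then show "\<sigma> \<in> {\<sigma>. syntheme \<sigma> \<and> isect \<alpha> \<sigma> \<noteq> central \<alpha>}"
      unfolding phi_edges_def block by (auto simp: R_def syntheme_phi_transp)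
  next
    fix \<sigma>
    assume "\<sigma> \<in> {\<sigma>. syntheme \<sigma> \<and> isect \<alpha> \<sigma> \<noteq> central \<alpha>}"
    \<comment> \<open>Every syntheme is an edge of the complete graph, so no degenerate one is
      missed.\<close>
    then show "\<sigma> \<in> phi_edges (UNIV // R)"
      unfolding phi_edges_def block by (auto simp: R_def elim: syntheme_imp_phi_transp)
  qed
  then show ?thesis
    using partition_on_quotient [OF equiv] by blast
qed

section \<open>Counting edges\<close>

lemma card_phi_edges:
  assumes "partition_on UNIV P"
  shows "card (phi_edges P) = (\<Sum>B\<in>P. card B choose 2)"
proof -
  \<comment> \<open>An edge corresponds to its set of endpoints, a 2-subset of a block; being
    nonempty, it lies in only one block.\<close>
  have "bij_betw support (phi_edges P) (\<Union>B\<in>P. {S. S \<subseteq> B \<and> card S = 2})"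
  proof (rule bij_betwI')
    show "support \<sigma> = support \<tau> \<longleftrightarrow> \<sigma> = \<tau>" if "\<sigma> \<in> phi_edges P" "\<tau> \<in> phi_edges P" for \<sigma> \<tau>
      using that by (auto simp: phi_edges_def support_phi_transp doubleton_eq_iff transpose_commute)
    show "support \<sigma> \<in> (\<Union>B\<in>P. {S. S \<subseteq> B \<and> card S = 2})" if "\<sigma> \<in> phi_edges P" for \<sigma>
      using that by (auto simp: phi_edges_def support_phi_transp)
    show "\<exists>\<sigma>\<in>phi_edges P. S = support \<sigma>" if "S \<in> (\<Union>B\<in>P. {S. S \<subseteq> B \<and> card S = 2})" for S
    proof -
      from that obtain B i j where "B \<in> P" "i \<in> B" "j \<in> B" "i \<noteq> j" "S = {i, j}"
        by (auto simp: card_2_iff)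
      then show ?thesis
        using support_phi_transp by (intro bexI [of _ "phi (transp i j)"]) (auto simp: phi_edges_def)
    qed
  qed
  then have "card (phi_edges P) = card (\<Union>B\<in>P. {S. S \<subseteq> B \<and> card S = 2})"
    by (rule bij_betw_same_card)
  also have "\<dots> = (\<Sum>B\<in>P. card {S. S \<subseteq> B \<and> card S = 2})"
  proof (rule card_UN_disjoint)
    show "\<forall>B\<in>P. \<forall>C\<in>P. B \<noteq> C \<longrightarrow>
        {S. S \<subseteq> B \<and> card S = 2} \<inter> {S. S \<subseteq> C \<and> card S = 2} = {}"
    proof (intro ballI impI equals0I)
      fix B C S
      assume *: "B \<in> P" "C \<in> P" "B \<noteq> C"
        and "S \<in> {S. S \<subseteq> B \<and> card S = 2} \<inter> {S. S \<subseteq> C \<and> card S = 2}"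
      then have "S \<subseteq> B \<inter> C" "S \<noteq> {}"
        by auto
      moreover have "B \<inter> C = {}"
        by (rule disjointD [OF partition_onD2 [OF assms] *])
      ultimately show False
        by blast
    qed
  qed auto
  also have "\<dots> = (\<Sum>B\<in>P. card B choose 2)"
    by (simp add: n_subsets)
  finally show ?thesis .
qed

text \<open>Blocks are grouped by size; the fibre over a size is its multiplicity in the
  type.\<close>

lemma m_nu_partition_type:
  "m_nu (partition_type P) = (\<Sum>B\<in>P. card B choose 2)"
proof -
  have "(\<Sum>B\<in>P. card B choose 2) = (\<Sum>i\<in>card ` P. \<Sum>B | B \<in> P \<and> card B = i. card B choose 2)"
    by (rule sum.image_gen) simp
  also have "\<dots> = (\<Sum>i\<in>card ` P. card {B \<in> P. card B = i} * (i choose 2))"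
    by (intro sum.cong) auto
  also have "\<dots> = m_nu (partition_type P)"
    by (auto simp: m_nu_def partition_type_def count_image_mset vimage_def Int_def conj_commute intro!: sum.cong)
  finally show ?thesis ..
qed

theorem theorem13:
  fixes \<alpha> :: "6 \<Rightarrow> 'k::field ^ 3"
  assumes "generic_arrangement \<alpha>"
  shows "(\<exists>!P. partition_on UNIV P \<and>
            nonvery_generic \<alpha> = {\<Inter>L\<in>T. D \<alpha> L | T. \<exists>\<sigma>\<in>phi_edges P. corresponds \<sigma> T}) \<and>
         (\<forall>P. partition_on UNIV P \<and>
            nonvery_generic \<alpha> = {\<Inter>L\<in>T. D \<alpha> L | T. \<exists>\<sigma>\<in>phi_edges P. corresponds \<sigma> T}
            \<longrightarrow> m3 \<alpha> = m_nu (partition_type P))"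
  unfolding nonvery_generic_eq_iff [OF assms]
proof (intro conjI allI impI)
  show "\<exists>!P. partition_on UNIV P \<and> phi_edges P = {\<sigma>. syntheme \<sigma> \<and> isect \<alpha> \<sigma> \<noteq> central \<alpha>}"
    using ex_partition_phi_edges [OF assms] phi_edges_inj by (metis (no_types, lifting))
  fix P
  assume P: "partition_on UNIV P \<and> phi_edges P = {\<sigma>. syntheme \<sigma> \<and> isect \<alpha> \<sigma> \<noteq> central \<alpha>}"
  \<comment> \<open>\<open>m3\<close> counts subspaces, the edges are synthemes; injectivity equates
    the two numbers.\<close>
  have "inj_on (isect \<alpha>) {\<sigma>. syntheme \<sigma> \<and> isect \<alpha> \<sigma> \<noteq> central \<alpha>}"
    using isect_inj [OF assms] by (intro inj_onI) blast
  then have "m3 \<alpha> = card (phi_edges P)"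
    using P by (simp add: m3_def nonvery_generic_eq [OF assms] card_image)
  then show "m3 \<alpha> = m_nu (partition_type P)"
    by (simp only: card_phi_edges [OF conjunct1 [OF P]] m_nu_partition_type)
qed

end
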